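(* Let $n$ be a positive integer and let $D_{2n}=\langle a,b : a^n=b^2=e,\ bab^{-1}=a^{-1}\rangle$ be the dihedral group of order $2n$. Then $$W(\mathrm{ESCom}(D_{2n}))=\begin{cases}\frac12(7n^2-5n), & \text{if } n \text{ is odd},\\ \frac12(7n^2-8n), & \text{if } n \text{ is even}.\end{cases}$$
   Context: All graphs are simple and undirected. For a finite group $G$, the equality supercommuting graph $\mathrm{ESCom}(G)$ is the commuting graph of $G$: its vertex set is $G$ (all elements), and distinct $g,h\in G$ are adjacent if and only if $gh=hg$. The Wiener index $W(\Gamma)$ of a connected graph $\Gamma$ is the sum of the distances $d_\Gamma(u,v)$ (lengths of shortest paths) over all unordered pairs of distinct vertices $u,v$ of $\Gamma$. *)

theory Defs
  imports
    "HOL-Algebra.Generated_Groups"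
    "Graph_Theory.Graph_Theory"
begin

section \<open>Distance and Wiener index\<close>

text \<open>
  A simple undirected graph is a symmetric loop-free digraph (\<^locale>\<open>pair_bidirected_digraph\<close>):
  the edge \<open>{u, v}\<close> is the pair of arcs \<open>(u, v)\<close>, \<open>(v, u)\<close>.
  With unit weights the cost of a walk is its length, so the shortest-path distance is the usual
  one; it is \<open>\<infinity>\<close> when no walk from \<open>u\<close> to \<open>v\<close> exists.
\<close>

definition gdist :: "'a pair_pre_digraph \<Rightarrow> 'a \<Rightarrow> 'a \<Rightarrow> ereal" where
  "gdist \<Gamma> u v = wf_digraph.\<mu> (with_proj \<Gamma>) (\<lambda>_. 1) u v"

lemma gdist_sym:
  assumes "pair_sym_digraph \<Gamma>"
  shows "gdist \<Gamma> u v = gdist \<Gamma> v u"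
proof -
  interpret pair_sym_digraph \<Gamma> by fact
  have swap: "(y, x) \<in> parcs \<Gamma>" if "(x, y) \<in> parcs \<Gamma>" for x y
    using that pair_sym_arcs by (auto simp: symmetric_def sym_def)
  have rev_ex: "\<exists>q. awalk y q x \<and> length q = length p" if "awalk x p y" for x p y
    using that
  proof (induction p arbitrary: x)
    case Nil
    then show ?case by (intro exI[of _ "[]"]) (auto simp: awalk_Nil_iff)
  next
    case (Cons e p)
    obtain z where e: "e = (x, z)" "(x, z) \<in> parcs \<Gamma>" and p: "awalk z p y"
      using Cons.prems by (cases e) (auto simp: awalk_Cons_iff)
    obtain q where q: "awalk y q z" "length q = length p"
      using Cons.IH[OF p] by blast
    have "awalk z [(z, x)] x"
      using swap[OF e(2)] in_arcsD1[OF e(2)] in_arcsD2[OF e(2)]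
      by (auto simp: awalk_Cons_iff awalk_Nil_iff)
    then have "awalk y (q @ [(z, x)]) x"
      using q(1) by auto
    then show ?case using q(2) by (intro exI[of _ "q @ [(z, x)]"]) auto
  qed
  have cost: "awalk_cost (\<lambda>_. 1) p = real (length p)" for p :: "('a \<times> 'a) list"
    by (induction p) auto
  have sub: "(\<lambda>p. ereal (awalk_cost (\<lambda>_. 1) p)) ` {p. awalk x p y}
      \<subseteq> (\<lambda>p. ereal (awalk_cost (\<lambda>_. 1) p)) ` {p. awalk y p x}" for x y
  proof (rule image_subsetI)
    fix p assume "p \<in> {p. awalk x p y}"
    then obtain q where "awalk y q x" "length q = length p" using rev_ex by blast
    then show "ereal (awalk_cost (\<lambda>_. 1) p)
        \<in> (\<lambda>p. ereal (awalk_cost (\<lambda>_. 1) p)) ` {p. awalk y p x}"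
      by (intro image_eqI[of _ _ q]) (simp_all only: cost mem_Collect_eq)
  qed
  show ?thesis
    unfolding gdist_def \<mu>_def by (rule arg_cong[where f = Inf], rule equalityI[OF sub sub])
qed

text \<open>
  The sum ranges over the two-element sets of vertices. The description operator is well defined
  on undirected graphs by symmetry of the distance. The value is finite only if the (finite)
  graph is connected, so no junk value arises for disconnected graphs.
\<close>

definition pair_gdist :: "'a pair_pre_digraph \<Rightarrow> 'a set \<Rightarrow> ereal" where
  "pair_gdist \<Gamma> e = (THE d. \<exists>u v. e = {u, v} \<and> d = gdist \<Gamma> u v)"

lemma pair_gdist_eq:
  assumes "pair_sym_digraph \<Gamma>"
  shows "pair_gdist \<Gamma> {u, v} = gdist \<Gamma> u v"
  unfolding pair_gdist_def
  using gdist_sym[OF assms] by (intro the_equality) (auto simp: doubleton_eq_iff)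

definition wiener_index :: "'a pair_pre_digraph \<Rightarrow> ereal" where
  "wiener_index \<Gamma> = (\<Sum>e \<in> {e. e \<subseteq> pverts \<Gamma> \<and> card e = 2}. pair_gdist \<Gamma> e)"


section \<open>The commuting graph\<close>

definition escom :: "('g, 'm) monoid_scheme \<Rightarrow> 'g pair_pre_digraph" where
  "escom G = \<lparr> pverts = carrier G,
     parcs = {(g, h). g \<in> carrier G \<and> h \<in> carrier G \<and> g \<noteq> h \<and> g \<otimes>\<^bsub>G\<^esub> h = h \<otimes>\<^bsub>G\<^esub> g} \<rparr>"

lemma pair_bidirected_digraph_escom: "pair_bidirected_digraph (escom G)"
  by unfold_locales (auto simp: escom_def symmetric_def sym_def)


section \<open>Dihedral groups\<close>

locale dihedral_relations = group G for G (structure) +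
  fixes n :: nat and a b
  assumes a_closed: "a \<in> carrier G" and b_closed: "b \<in> carrier G"
    and a_pow: "a [^] n = \<one>" and b_pow: "b [^] (2::nat) = \<one>"
    and conj_rel: "b \<otimes> a \<otimes> inv b = inv a"

text \<open>
  The group of order \<open>2n\<close> generated by \<open>a\<close> and \<open>b\<close> subject to the relations. For \<open>n > 0\<close>, such a
  group exists (\<open>dihedral_group_exists\<close>) and it has the universal property of the presentation
  \<open>\<langle>a, b : a\<^sup>n = b\<^sup>2 = e, bab\<^sup>-\<^sup>1 = a\<^sup>-\<^sup>1\<rangle>\<close> (\<open>dihedral_group_universal\<close>); in particular it is
  unique up to isomorphism. For \<open>n = 1, 2\<close> it is the cyclic group of order 2 and the Klein four-group.
\<close>

locale dihedral_group = dihedral_relations +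
  assumes generated: "carrier G = generate G {a, b}"
    and order_eq: "order G = 2 * n"

subsection \<open>Existence and universal property\<close>

text \<open>The pair \<open>(i, s)\<close> stands for \<open>a\<^sup>i\<close> or \<open>a\<^sup>i b\<close>, according to \<open>s\<close>.\<close>

definition dihedral_model :: "nat \<Rightarrow> (int \<times> bool) monoid" where
  "dihedral_model n = \<lparr> carrier = {0..<int n} \<times> UNIV,
     monoid.mult = (\<lambda>(i, s) (j, t). ((if s then i - j else i + j) mod int n, s \<noteq> t)),
     monoid.one = (0, False) \<rparr>"

context dihedral_relations
begin

definition nf :: "int \<times> bool \<Rightarrow> 'a" where
  "nf = (\<lambda>(i, s). a [^] i \<otimes> (if s then b else \<one>))"

lemma b_b: "b \<otimes> b = \<one>"
  using b_pow b_closed by (simp add: numeral_2_eq_2)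

lemma b_a_pow: "b \<otimes> a [^] (i::int) = a [^] (- i) \<otimes> b"
proof -
  have inv_b: "inv b = b"
    using b_b b_closed by (simp add: inv_equality)
  have ba: "b \<otimes> a = inv a \<otimes> b"
  proof -
    have "b \<otimes> a = b \<otimes> a \<otimes> inv b \<otimes> b"
      using a_closed b_closed by (simp add: m_assoc)
    then show ?thesis using conj_rel by simp
  qed
  have nat: "b \<otimes> a [^] k = inv a [^] k \<otimes> b" for k :: nat
  proof (induction k)
    case 0
    then show ?case using b_closed by simp
  next
    case (Suc k)
    have "b \<otimes> a [^] Suc k = (b \<otimes> a [^] k) \<otimes> a"
      using a_closed b_closed by (simp add: m_assoc)
    also have "\<dots> = inv a [^] k \<otimes> (b \<otimes> a)"
      using Suc a_closed b_closed by (simp add: m_assoc)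
    also have "\<dots> = inv a [^] Suc k \<otimes> b"
      using ba a_closed b_closed by (simp add: m_assoc)
    finally show ?case .
  qed
  have nat': "b \<otimes> a [^] int k = a [^] (- int k) \<otimes> b" for k
    using nat[of k] a_closed by (simp add: int_pow_neg int_pow_int nat_pow_inv)
  show ?thesis
  proof (cases "i \<ge> 0")
    case True
    then show ?thesis using nat'[of "nat i"] by simp
  next
    case False
    define k where "k = nat (- i)"
    have i: "i = - int k" using False by (simp add: k_def)
    have "b \<otimes> a [^] i = b \<otimes> (a [^] (- int k) \<otimes> b) \<otimes> b"
      using b_b a_closed b_closed by (simp add: i m_assoc)
    also have "\<dots> = b \<otimes> (b \<otimes> a [^] int k) \<otimes> b"
      using nat'[of k] by simp
    also have "\<dots> = (b \<otimes> b) \<otimes> (a [^] int k \<otimes> b)"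
      using a_closed b_closed by (simp add: m_assoc del: int_pow_int)
    also have "\<dots> = a [^] (- i) \<otimes> b"
      using b_b a_closed b_closed by (simp add: i)
    finally show ?thesis .
  qed
qed

lemma a_pow_mod: "a [^] (i mod int n) = a [^] (i::int)"
proof -
  have "a [^] i = a [^] (int n * (i div int n) + i mod int n)" by simp
  also have "\<dots> = (a [^] int n) [^] (i div int n) \<otimes> a [^] (i mod int n)"
    using a_closed by (simp only: int_pow_mult int_pow_pow)
  finally show ?thesis using a_pow a_closed by (simp add: int_pow_int)
qed

lemma nf_closed: "nf x \<in> carrier G"
  using a_closed b_closed by (auto simp: nf_def split: prod.split)

lemma nf_mult:
  "nf (x \<otimes>\<^bsub>dihedral_model n\<^esub> y) = nf x \<otimes> nf y"
proof -
  obtain i s j t where x: "x = (i, s)" and y: "y = (j, t)" by (cases x, cases y) auto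
  have L: "nf (x \<otimes>\<^bsub>dihedral_model n\<^esub> y)
      = a [^] (if s then i - j else i + j) \<otimes> (if s \<noteq> t then b else \<one>)"
    by (simp add: x y dihedral_model_def nf_def a_pow_mod)
  show ?thesis
  proof (cases s)
    case False
    then show ?thesis unfolding L
      using a_closed b_closed by (simp add: x y nf_def int_pow_mult m_assoc)
  next
    case True
    define c where "c = (if t then b else \<one>)"
    have c: "c \<in> carrier G" using b_closed by (simp add: c_def)
    have bc: "b \<otimes> c = (if s \<noteq> t then b else \<one>)"
      using True b_b b_closed by (simp add: c_def)
    have "nf x \<otimes> nf y = (a [^] i \<otimes> (b \<otimes> a [^] j)) \<otimes> c"
      using True a_closed b_closed c by (simp add: x y nf_def c_def[symmetric] m_assoc)
    also have "\<dots> = (a [^] i \<otimes> a [^] (- j)) \<otimes> (b \<otimes> c)"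
      using b_a_pow a_closed b_closed c by (simp add: m_assoc)
    also have "\<dots> = a [^] (i - j) \<otimes> (b \<otimes> c)"
      using int_pow_mult[OF a_closed, of i "- j"] by simp
    finally show ?thesis using True by (simp add: L bc)
  qed
qed

end

lemma group_dihedral_model:
  assumes "n > 0"
  shows "group (dihedral_model n)"
proof (rule groupI)
  fix x y z
  assume "x \<in> carrier (dihedral_model n)" "y \<in> carrier (dihedral_model n)"
    "z \<in> carrier (dihedral_model n)"
  then show "x \<otimes>\<^bsub>dihedral_model n\<^esub> y \<otimes>\<^bsub>dihedral_model n\<^esub> z
      = x \<otimes>\<^bsub>dihedral_model n\<^esub> (y \<otimes>\<^bsub>dihedral_model n\<^esub> z)"
    by (auto simp: dihedral_model_def mod_simps algebra_simps)
next
  fix x assume x: "x \<in> carrier (dihedral_model n)"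
  obtain i s where xi: "x = (i, s)" by (cases x)
  have "(if s then i else (- i) mod int n, s) \<in> carrier (dihedral_model n)"
    using x assms by (auto simp: xi dihedral_model_def)
  moreover have "(if s then i else (- i) mod int n, s) \<otimes>\<^bsub>dihedral_model n\<^esub> x
      = \<one>\<^bsub>dihedral_model n\<^esub>"
    by (auto simp: xi dihedral_model_def mod_simps)
  ultimately show "\<exists>y\<in>carrier (dihedral_model n).
      y \<otimes>\<^bsub>dihedral_model n\<^esub> x = \<one>\<^bsub>dihedral_model n\<^esub>" by blast
qed (use assms in \<open>auto simp: dihedral_model_def\<close>)

lemma dihedral_group_exists:
  assumes "n > 0"
  shows "dihedral_group (dihedral_model n) n (1 mod int n, False) (0, True)"
proof -
  let ?G = "dihedral_model n" and ?a = "(1 mod int n, False)" and ?b = "(0::int, True)"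
  interpret group ?G by (rule group_dihedral_model[OF assms])
  have a: "?a \<in> carrier ?G" and b: "?b \<in> carrier ?G"
    using assms by (auto simp: dihedral_model_def)
  have pow: "?a [^]\<^bsub>?G\<^esub> k = (int k mod int n, False)" for k :: nat
    by (induction k) (auto simp: dihedral_model_def mod_simps algebra_simps)
  have bb: "?b \<otimes>\<^bsub>?G\<^esub> ?b = \<one>\<^bsub>?G\<^esub>"
    by (simp add: dihedral_model_def)
  have inv_b: "inv\<^bsub>?G\<^esub> ?b = ?b"
    using inv_equality[OF bb b b] .
  have baba: "(?b \<otimes>\<^bsub>?G\<^esub> ?a \<otimes>\<^bsub>?G\<^esub> ?b) \<otimes>\<^bsub>?G\<^esub> ?a = \<one>\<^bsub>?G\<^esub>"
    by (simp add: dihedral_model_def mod_simps)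
  have conj: "?b \<otimes>\<^bsub>?G\<^esub> ?a \<otimes>\<^bsub>?G\<^esub> inv\<^bsub>?G\<^esub> ?b = inv\<^bsub>?G\<^esub> ?a"
    using inv_equality[OF baba a] a b inv_b by simp
  have gen_pow: "?a [^]\<^bsub>?G\<^esub> k \<in> generate ?G {?a, ?b}" for k :: nat
    by (induction k) (auto intro: generate.intros)
  have "x \<in> generate ?G {?a, ?b}" if x: "x \<in> carrier ?G" for x
  proof -
    obtain i s where xi: "x = (i, s)" by (cases x)
    have i: "0 \<le> i" "i < int n" using x by (auto simp: xi dihedral_model_def)
    have p: "(i, False) = ?a [^]\<^bsub>?G\<^esub> nat i" using i by (simp add: pow)
    have q: "(i, True) = (i, False) \<otimes>\<^bsub>?G\<^esub> ?b" using i by (simp add: dihedral_model_def)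
    have "?b \<in> generate ?G {?a, ?b}" by (auto intro: generate.incl)
    then show ?thesis
      using gen_pow[of "nat i"] by (cases s) (auto simp: xi q p[symmetric] intro: generate.eng)
  qed
  then have gen: "carrier ?G = generate ?G {?a, ?b}"
    using generate_incl[of "{?a, ?b}"] a b by blast
  show ?thesis
  proof unfold_locales
    show "?a [^]\<^bsub>?G\<^esub> n = \<one>\<^bsub>?G\<^esub>" unfolding pow by (simp add: dihedral_model_def)
    show "?b [^]\<^bsub>?G\<^esub> (2::nat) = \<one>\<^bsub>?G\<^esub>" using bb b by (simp add: numeral_2_eq_2)
    show "order ?G = 2 * n"
      by (simp add: order_def dihedral_model_def card_cartesian_product)
  qed (fact a b conj gen)+
qed

lemma dihedral_group_universal:
  assumes "n > 0" and "dihedral_group G n a b" and "dihedral_relations H n x y"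
  shows "\<exists>f \<in> hom G H. f a = x \<and> f b = y"
proof -
  interpret G: dihedral_group G n a b by fact
  interpret H: dihedral_relations H n x y by fact
  let ?M = "dihedral_model n"
  interpret M: group ?M by (rule group_dihedral_model[OF \<open>n > 0\<close>])
  have hG: "G.nf \<in> hom ?M G" using G.nf_mult G.nf_closed by (auto simp: hom_def)
  have hH: "H.nf \<in> hom ?M H" using H.nf_mult H.nf_closed by (auto simp: hom_def)
  interpret f: group_hom ?M G G.nf
    using hG by unfold_locales
  let ?a = "(1 mod int n, False)" and ?b = "(0::int, True)"
  have ab: "?a \<in> carrier ?M" "?b \<in> carrier ?M"
    using \<open>n > 0\<close> by (auto simp: dihedral_model_def)
  have Gab: "G.nf ?a = a" "G.nf ?b = b"
    using G.a_closed G.b_closed by (simp_all add: G.nf_def G.a_pow_mod)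
  have Hab: "H.nf ?a = x" "H.nf ?b = y"
    using H.a_closed H.b_closed by (simp_all add: H.nf_def H.a_pow_mod)
  have sub: "subgroup (G.nf ` carrier ?M) G" by (rule f.img_is_subgroup)
  have "{a, b} \<subseteq> G.nf ` carrier ?M"
    using ab Gab by (metis empty_subsetI image_eqI insert_subset)
  then have "generate G {a, b} \<subseteq> G.nf ` carrier ?M"
    using sub by (rule G.generate_subgroup_incl)
  then have surj: "G.nf ` carrier ?M = carrier G"
    using G.generated G.nf_closed by blast
  have "card (carrier ?M) = card (carrier G)"
    using G.order_eq by (simp add: order_def dihedral_model_def card_cartesian_product)
  then have inj: "inj_on G.nf (carrier ?M)"
    using surj by (intro eq_card_imp_inj_on) (auto simp: dihedral_model_def)
  then have "G.nf \<in> iso ?M G"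
    using hG surj by (auto simp: Group.iso_def bij_betw_def)
  then have inv_hom: "inv_into (carrier ?M) G.nf \<in> hom G ?M"
    using M.iso_set_sym[of G.nf G] by (auto simp: Group.iso_def)
  have "H.nf \<circ> inv_into (carrier ?M) G.nf \<in> hom G H"
    using hom_compose[OF inv_hom hH] .
  moreover have "inv_into (carrier ?M) G.nf a = ?a" "inv_into (carrier ?M) G.nf b = ?b"
    using inv_into_f_f[OF inj ab(1)] inv_into_f_f[OF inj ab(2)] Gab by simp_all
  ultimately show ?thesis using Hab by (intro bexI[of _ "H.nf \<circ> inv_into (carrier ?M) G.nf"]) auto
qed

end

theory Submission
  imports Defs
begin

text \<open>
  The identity is adjacent to every other vertex, so two distinct elements have distance 1 if they
  commute and 2 otherwise. Hence \<open>2 W = 2 |G|\<^sup>2 - |G| - c\<close>, where \<open>c\<close> is the number of ordered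
  commuting pairs. In the dihedral group two rotations always commute; a rotation \<open>a\<^sup>i\<close> commutes
  with a reflection iff \<open>n dvd 2 i\<close>, and two reflections \<open>a\<^sup>i b\<close>, \<open>a\<^sup>j b\<close> commute iff
  \<open>n dvd 2 (i - j)\<close>. So \<open>c = n\<^sup>2 + 3 n z\<close>, where \<open>z\<close> is the number of residues \<open>i\<close> modulo \<open>n\<close>
  with \<open>n dvd 2 i\<close>.
\<close>

section \<open>The Wiener index of a commuting graph\<close>

text \<open>\<open>gdist\<close> is an infimum of walk costs, and unit weights make each cost a
  length, so exhibiting one shortest walk determines the value.\<close>

lemma gdist_eqI:
  fixes \<Gamma> :: "'a pair_pre_digraph"
  assumes "pair_wf_digraph \<Gamma>"
    and "pre_digraph.awalk (with_proj \<Gamma>) u p v"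
    and "\<And>q. pre_digraph.awalk (with_proj \<Gamma>) u q v \<Longrightarrow> length p \<le> length q"
  shows "gdist \<Gamma> u v = ereal (real (length p))"
proof -
  interpret pair_wf_digraph \<Gamma> by fact
  have cost: "awalk_cost (\<lambda>_. 1) q = real (length q)" for q :: "('a \<times> 'a) list"
    by (induction q) auto
  show ?thesis
    unfolding gdist_def \<mu>_def cost
    using assms(2,3) by (intro antisym INF_greatest INF_lower2[of p]) auto
qed

lemma gdist_escom:
  assumes "group G" and u: "u \<in> carrier G" and v: "v \<in> carrier G" and "u \<noteq> v"
  shows "gdist (escom G) u v = ereal (if u \<otimes>\<^bsub>G\<^esub> v = v \<otimes>\<^bsub>G\<^esub> u then 1 else 2)"
proof -
  interpret G: group G by fact
  interpret pair_bidirected_digraph "escom G" by (rule pair_bidirected_digraph_escom)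
  have wf: "pair_wf_digraph (escom G)" by unfold_locales
  have V: "pverts (escom G) = carrier G"
    and A: "(x, y) \<in> parcs (escom G) \<longleftrightarrow> x \<in> carrier G \<and> y \<in> carrier G \<and> x \<noteq> y
      \<and> x \<otimes>\<^bsub>G\<^esub> y = y \<otimes>\<^bsub>G\<^esub> x" for x y
    by (simp_all add: escom_def)
  have nonempty: "length q \<ge> 1" if "awalk u q v" for q
    using that \<open>u \<noteq> v\<close> by (cases q) (auto simp: awalk_Nil_iff)
  show ?thesis
  proof (cases "u \<otimes>\<^bsub>G\<^esub> v = v \<otimes>\<^bsub>G\<^esub> u")
    case True
    have "awalk u [(u, v)] v"
      using True u v \<open>u \<noteq> v\<close> by (auto simp: awalk_Cons_iff awalk_Nil_iff V A)
    from gdist_eqI[OF wf this] nonempty True show ?thesis by simp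
  next
    case False
    \<comment> \<open>The graph has no loops, so the two steps through the identity are arcs only if
      neither endpoint is the identity.\<close>
    have "u \<noteq> \<one>\<^bsub>G\<^esub>" "v \<noteq> \<one>\<^bsub>G\<^esub>" using False u v by auto
    then have walk: "awalk u [(u, \<one>\<^bsub>G\<^esub>), (\<one>\<^bsub>G\<^esub>, v)] v"
      using u v by (auto simp: awalk_Cons_iff awalk_Nil_iff V A)
    have "length q \<ge> 2" if q: "awalk u q v" for q
    proof (rule ccontr)
      assume "\<not> length q \<ge> 2"
      then have "length q = 1" using nonempty[OF q] by linarith
      then obtain e where "q = [e]" by (auto simp: length_Suc_conv)
      then have "(u, v) \<in> parcs (escom G)"
        using q by (cases e) (auto simp: awalk_Cons_iff awalk_Nil_iff)
      then show False using False by (simp add: A)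
    qed
    then have "gdist (escom G) u v = ereal (real (length [(u, \<one>\<^bsub>G\<^esub>), (\<one>\<^bsub>G\<^esub>, v)]))"
      by (intro gdist_eqI[OF wf walk]) (simp add: numeral_2_eq_2)
    then show ?thesis using False by simp
  qed
qed

text \<open>The fibre of \<open>(u, v)\<close> to \<open>{u, v}\<close> over a two-element set
  consists of its two orderings. This turns the Wiener index into a count of ordered pairs.\<close>

lemma sum_doubletons:
  fixes g :: "'a set \<Rightarrow> real"
  assumes "finite V"
  shows "(\<Sum>(u, v) \<in> {(u, v). u \<in> V \<and> v \<in> V \<and> u \<noteq> v}. g {u, v})
    = 2 * (\<Sum>e \<in> {e. e \<subseteq> V \<and> card e = 2}. g e)"
proof -
  let ?P = "{(u, v). u \<in> V \<and> v \<in> V \<and> u \<noteq> v}" and ?E = "{e. e \<subseteq> V \<and> card e = 2}"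
  let ?s = "\<lambda>(u, v). {u, v}"
  have P: "finite ?P" by (rule finite_subset[of _ "V \<times> V"]) (use assms in auto)
  have E: "finite ?E" using assms by simp
  have "(\<Sum>(u, v) \<in> ?P. g {u, v}) = (\<Sum>e \<in> ?E. \<Sum>p \<in> {p \<in> ?P. ?s p = e}. g (?s p))"
    by (subst sum.group[OF P E]) (auto simp: split_def)
  also have "\<dots> = (\<Sum>e \<in> ?E. 2 * g e)"
  proof (rule sum.cong[OF refl])
    fix e assume "e \<in> ?E"
    then obtain u v where e: "e = {u, v}" "u \<noteq> v" "u \<in> V" "v \<in> V"
      by (auto simp: card_2_iff)
    have "{p \<in> ?P. ?s p = e} = {(u, v), (v, u)}"
      using e by (auto simp: doubleton_eq_iff)
    then show "(\<Sum>p \<in> {p \<in> ?P. ?s p = e}. g (?s p)) = 2 * g e"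
      using e by (simp add: insert_commute)
  qed
  finally show ?thesis by (simp add: sum_distrib_left)
qed

definition commuting_pairs :: "('g, 'm) monoid_scheme \<Rightarrow> ('g \<times> 'g) set" where
  "commuting_pairs G =
    {(x, y). x \<in> carrier G \<and> y \<in> carrier G \<and> x \<otimes>\<^bsub>G\<^esub> y = y \<otimes>\<^bsub>G\<^esub> x}"

text \<open>Twice the index sums 2 minus the indicator of commuting over the ordered pairs off the
  diagonal. There are \<open>|G|^2 - |G|\<close> of these, and \<open>c - |G|\<close> of them
  commute, since \<open>commuting_pairs\<close> contains the diagonal.\<close>

lemma wiener_index_escom:
  assumes "group G" and fin: "finite (carrier G)"
  shows "wiener_index (escom G) =
    ereal ((2 * real (order G) ^ 2 - real (order G) - real (card (commuting_pairs G))) / 2)"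
proof -
  interpret pair_bidirected_digraph "escom G" by (rule pair_bidirected_digraph_escom)
  let ?V = "carrier G"
  let ?P = "{(u, v). u \<in> ?V \<and> v \<in> ?V \<and> u \<noteq> v}" and ?E = "{e. e \<subseteq> ?V \<and> card e = 2}"
  let ?C = "commuting_pairs G" and ?D = "(\<lambda>u. (u, u)) ` ?V"
  \<comment> \<open>Passing to reals makes subtraction and division safe; nothing is lost, since
    \<open>d\<close> shows that all the distances involved are finite.\<close>
  define g where "g e = real_of_ereal (pair_gdist (escom G) e)" for e
  have d: "pair_gdist (escom G) {u, v} = ereal (if (u, v) \<in> ?C then 1 else 2)"
    if "(u, v) \<in> ?P" for u v
    using that gdist_escom[OF \<open>group G\<close>, of u v] pair_gdist_eq[of "escom G" u v]
      pair_sym_digraph_axioms by (auto simp: commuting_pairs_def)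
  have PD: "?P = ?V \<times> ?V - ?D" and DC: "?D \<subseteq> ?C" and CV: "?C \<subseteq> ?V \<times> ?V"
    by (auto simp: commuting_pairs_def)
  have finC: "finite ?C" using CV fin by (blast intro: finite_subset)
  have D: "card ?D = card ?V" by (rule card_image) (auto simp: inj_on_def)
  have P: "real (card ?P) = real (card ?V) ^ 2 - real (card ?V)"
    unfolding PD using fin D DC CV card_mono[of "?V \<times> ?V" ?D]
    by (subst card_Diff_subset) (auto simp: card_cartesian_product power2_eq_square of_nat_diff)
  have C: "real (card (?P \<inter> ?C)) = real (card ?C) - real (card ?V)"
  proof -
    have "?P \<inter> ?C = ?C - ?D" using CV by (auto simp: PD)
    then show ?thesis
      using finC DC D card_mono[OF finC DC] fin by (simp add: card_Diff_subset of_nat_diff)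
  qed
  have finP: "finite ?P" using fin by (simp add: PD)
  have "2 * (\<Sum>e \<in> ?E. g e) = (\<Sum>(u, v) \<in> ?P. g {u, v})"
    using sum_doubletons[OF fin] by simp
  also have "\<dots> = (\<Sum>p \<in> ?P. 2 - of_bool (p \<in> ?C))"
    by (rule sum.cong) (auto simp: g_def d)
  also have "\<dots> = 2 * real (card ?P) - real (card (?P \<inter> ?C))"
    using finP by (simp add: sum_subtractf sum_of_bool_eq Int_def)
  finally have g: "(\<Sum>e \<in> ?E. g e)
      = (2 * real (card ?V) ^ 2 - real (card ?V) - real (card ?C)) / 2"
    unfolding P C by simp
  have "pair_gdist (escom G) e = ereal (g e)" if "e \<in> ?E" for e
    using that d by (auto simp: card_2_iff g_def)
  then have "wiener_index (escom G) = ereal (\<Sum>e \<in> ?E. g e)"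
    by (simp add: wiener_index_def escom_def)
  then show ?thesis by (simp add: g order_def)
qed

section \<open>Commuting pairs in dihedral groups\<close>

text \<open>An isomorphism preserves commutation and, being injective, also reflects it. Hence the
  count may be done in the concrete model.\<close>

lemma bij_betw_commuting_pairs:
  assumes "h \<in> iso G H" "group G"
  shows "bij_betw (map_prod h h) (commuting_pairs G) (commuting_pairs H)"
proof -
  interpret group G by fact
  have hom: "h (x \<otimes>\<^bsub>G\<^esub> y) = h x \<otimes>\<^bsub>H\<^esub> h y" if "x \<in> carrier G" "y \<in> carrier G" for x y
    using assms that by (auto simp: iso_def hom_def)
  have inj: "inj_on h (carrier G)" and im: "h ` carrier G = carrier H"
    using assms by (auto simp: iso_def bij_betw_def)
  have iff: "h x \<otimes>\<^bsub>H\<^esub> h y = h y \<otimes>\<^bsub>H\<^esub> h x \<longleftrightarrow> x \<otimes>\<^bsub>G\<^esub> y = y \<otimes>\<^bsub>G\<^esub> x"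
    if "x \<in> carrier G" "y \<in> carrier G" for x y
    using that inj by (simp flip: hom add: inj_on_eq_iff)
  show ?thesis
    unfolding bij_betw_def
  proof
    show "inj_on (map_prod h h) (commuting_pairs G)"
      using inj by (auto simp: inj_on_def commuting_pairs_def)
    show "map_prod h h ` commuting_pairs G = commuting_pairs H"
      using iff by (force simp: commuting_pairs_def simp flip: im)
  qed
qed

text \<open>The image of \<open>nf\<close> is a subgroup containing both generators, hence
  everything; as both groups have \<open>2 * n\<close> elements, surjectivity forces
  injectivity.\<close>

lemma (in dihedral_group) nf_iso:
  assumes "n > 0"
  shows "nf \<in> iso (dihedral_model n) G"
proof -
  let ?M = "dihedral_model n"
  interpret M: group ?M by (rule group_dihedral_model[OF assms])
  have hom: "nf \<in> hom ?M G" using nf_mult nf_closed by (auto simp: hom_def)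
  interpret f: group_hom ?M G nf using hom by unfold_locales
  have "a = nf (1 mod int n, False)" "b = nf (0, True)"
    using a_closed b_closed by (simp_all add: nf_def a_pow_mod)
  moreover have "(1 mod int n, False) \<in> carrier ?M" "(0, True) \<in> carrier ?M"
    using assms by (auto simp: dihedral_model_def)
  ultimately have "{a, b} \<subseteq> nf ` carrier ?M" by blast
  then have surj: "nf ` carrier ?M = carrier G"
    using generate_subgroup_incl[OF _ f.img_is_subgroup] generated nf_closed by blast
  have "card (carrier ?M) = card (carrier G)"
    using order_eq by (simp add: order_def dihedral_model_def card_cartesian_product)
  then have "inj_on nf (carrier ?M)"
    using surj by (intro eq_card_imp_inj_on) (auto simp: dihedral_model_def)
  then show ?thesis using hom surj by (auto simp: iso_def bij_betw_def)
qed

text \<open>These residues represent the kernel of doubling on Z/n.\<close>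

definition two_torsion :: "nat \<Rightarrow> int set" where
  "two_torsion n = {i \<in> {0..<int n}. int n dvd 2 * i}"

text \<open>For odd \<open>n\<close>, 2 is invertible modulo \<open>n\<close>, leaving only 0. For
  \<open>n = 2 * m\<close> the condition cancels to \<open>m dvd i\<close>, leaving 0 and
  \<open>m\<close> below \<open>2 * m\<close>.\<close>

lemma card_two_torsion:
  assumes "n > 0"
  shows "card (two_torsion n) = (if odd n then 1 else 2)"
proof (cases "odd n")
  case True
  then have "coprime (int n) 2" by simp
  then have "i = 0" if "0 \<le> i" "i < int n" "int n dvd 2 * i" for i
    using that zdvd_imp_le[of "int n" i] by (cases "i = 0") (auto simp: coprime_dvd_mult_right_iff)
  then have "two_torsion n = {0}"
    using assms by (auto simp: two_torsion_def)
  then show ?thesis using True by simp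
next
  case False
  then obtain m where m: "n = 2 * m" by blast
  have "i = 0 \<or> i = int m" if "0 \<le> i" "i < 2 * int m" "int m dvd i" for i
  proof -
    obtain k where k: "i = int m * k" using \<open>int m dvd i\<close> by blast
    have "int m > 0" using assms by (simp add: m)
    moreover have "int m * k < int m * 2" using that by (simp only: k mult.commute)
    ultimately have "k < 2" "k \<ge> 0"
      using that mult_less_cancel_left_pos[of "int m" k 2] by (auto simp: k zero_le_mult_iff)
    then have "k = 0 \<or> k = 1" by auto
    then show ?thesis by (auto simp: k)
  qed
  then have "two_torsion n = {0, int m}"
    using assms by (auto simp: two_torsion_def m)
  then show ?thesis using False assms by (simp add: m)
qed

text \<open>For each fixed \<open>i\<close>, substituting \<open>k = i - j\<close> modulo
  \<open>n\<close> turns the condition into membership of \<open>k\<close> in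
  \<open>two_torsion n\<close>.\<close>

lemma card_two_torsion_differences:
  assumes "n > 0"
  shows "card {(i, j). i \<in> {0..<int n} \<and> j \<in> {0..<int n} \<and> int n dvd 2 * (i - j)}
    = n * card (two_torsion n)"
proof -
  let ?I = "{0..<int n}"
  let ?S = "{(i, j). i \<in> ?I \<and> j \<in> ?I \<and> int n dvd 2 * (i - j)}"
  have mod_dvd: "int n dvd 2 * (x mod int n) \<longleftrightarrow> int n dvd 2 * x" for x
    by (simp only: dvd_eq_mod_eq_0 mod_mult_right_eq)
  have diff_mod: "(i - (i - k) mod int n) mod int n = k mod int n" for i k
    by (simp only: mod_diff_right_eq) simp
  have "int n dvd 2 * (i - (i - k) mod int n) \<longleftrightarrow> int n dvd 2 * k" for i k
    by (simp only: mod_dvd[of "i - _", symmetric] diff_mod mod_dvd)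
  \<comment> \<open>With \<open>i\<close> fixed, reflecting \<open>k\<close> to \<open>i - k\<close>
    modulo \<open>n\<close> is an involution, so the witness for the inverse is the same
    formula.\<close>
  then have "bij_betw (\<lambda>(i, k). (i, (i - k) mod int n)) (?I \<times> two_torsion n) ?S"
    using assms
    by (intro bij_betw_byWitness[where f' = "\<lambda>(i, j). (i, (i - j) mod int n)"])
      (auto simp: two_torsion_def diff_mod mod_dvd)
  from bij_betw_same_card[OF this] show ?thesis
    by (simp add: card_cartesian_product)
qed

text \<open>The two Boolean flags split the pairs into four blocks: rotations with rotations give
  \<open>n ^ 2\<close>, and each of the other three gives
  \<open>n * card (two_torsion n)\<close>.\<close>

lemma card_commuting_pairs_dihedral_model:
  assumes "n > 0"
  shows "card (commuting_pairs (dihedral_model n)) = n ^ 2 + 3 * n * card (two_torsion n)"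
proof -
  let ?I = "{0..<int n}" and ?Z = "two_torsion n"
  let ?S = "{(i, j). i \<in> ?I \<and> j \<in> ?I \<and> int n dvd 2 * (i - j)}"
  let ?f = "\<lambda>s t (i, j). ((i, s), (j, t)) :: (int \<times> bool) \<times> (int \<times> bool)"
  \<comment> \<open>These compare the first coordinates of the two products in the mixed cases and
    for two reflections.\<close>
  have mod_eq: "(i + j) mod int n = (j - i) mod int n \<longleftrightarrow> int n dvd 2 * i"
    "(j - i) mod int n = (i + j) mod int n \<longleftrightarrow> int n dvd 2 * i"
    "(i - j) mod int n = (j - i) mod int n \<longleftrightarrow> int n dvd 2 * (i - j)" for i j
    unfolding mod_eq_dvd_iff using dvd_minus_iff[of "int n" "2 * i"] by (simp_all add: algebra_simps)
  have iff: "((i, s), (j, t)) \<in> commuting_pairs (dihedral_model n) \<longleftrightarrow> i \<in> ?I \<and> j \<in> ?I \<and>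
      (if s then if t then (i, j) \<in> ?S else j \<in> ?Z else t \<longrightarrow> i \<in> ?Z)" for i j s t
    \<comment> \<open>In the second fact \<open>j\<close> occurs first, so \<open>of i j\<close>
      exchanges the roles and yields the condition on \<open>j\<close> for a reflection paired with
      a rotation.\<close>
    using mod_eq(1,3)[of i j] mod_eq(2)[of i j]
    by (cases s; cases t)
      (auto simp: commuting_pairs_def dihedral_model_def two_torsion_def add.commute)
  have *: "commuting_pairs (dihedral_model n) =
      ?f False False ` (?I \<times> ?I) \<union> ?f False True ` (?Z \<times> ?I)
      \<union> ?f True False ` (?I \<times> ?Z) \<union> ?f True True ` ?S" (is "_ = ?A \<union> ?B \<union> ?C \<union> ?D")
  proof (rule Set.set_eqI)
    fix p :: "(int \<times> bool) \<times> (int \<times> bool)"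
    obtain i s j t where p: "p = ((i, s), (j, t))" by (metis surj_pair)
    show "p \<in> commuting_pairs (dihedral_model n) \<longleftrightarrow> p \<in> ?A \<union> ?B \<union> ?C \<union> ?D"
      unfolding p iff by (cases s; cases t) (auto simp: image_iff two_torsion_def)
  qed
  have "?Z \<subseteq> ?I" "?S \<subseteq> ?I \<times> ?I" by (auto simp: two_torsion_def)
  then have fin: "finite ?Z" "finite ?S" by - (erule finite_subset, simp)+
  have inj: "inj_on (?f s t) X" for s t X by (auto simp: inj_on_def)
  have disj: "?A \<inter> ?B = {}" "(?A \<union> ?B) \<inter> ?C = {}" "(?A \<union> ?B \<union> ?C) \<inter> ?D = {}"
    by auto
  have fin': "finite ?A" "finite ?B" "finite ?C" "finite ?D"
    using fin by simp_all
  have "card (?A \<union> ?B \<union> ?C \<union> ?D) = card ?A + card ?B + card ?C + card ?D"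
    by (simp only: card_Un_disjoint disj fin' finite_Un simp_thms)
  also have "\<dots> = n ^ 2 + 3 * n * card ?Z"
    unfolding card_image[OF inj] card_two_torsion_differences[OF assms]
    by (simp add: card_cartesian_product power2_eq_square)
  finally show ?thesis unfolding * .
qed

theorem theorem6p6:
  fixes G :: "('g, 'm) monoid_scheme" and n :: nat and a b :: 'g
  assumes "n > 0"
    and "dihedral_group G n a b"
  shows "wiener_index (escom G) =
    ereal (if odd n then 1 / 2 * (7 * real n ^ 2 - 5 * real n)
           else 1 / 2 * (7 * real n ^ 2 - 8 * real n))"
proof -
  interpret dihedral_group G n a b by fact
  have "finite (carrier G)"
    using order_eq \<open>n > 0\<close> by (intro card_ge_0_finite) (simp add: order_def)
  moreover have "card (commuting_pairs G) = n ^ 2 + 3 * n * (if odd n then 1 else 2)"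
    using bij_betw_same_card[OF bij_betw_commuting_pairs[OF nf_iso group_dihedral_model]]
      card_commuting_pairs_dihedral_model card_two_torsion \<open>n > 0\<close> by simp
  \<comment> \<open>With \<open>|G| = 2 * n\<close> and \<open>z\<close> the size of the
    two-torsion, twice the index is \<open>8n^2 - 2n - (n^2 + 3nz) = 7n^2 - (2 + 3z)n\<close>, where
    \<open>z\<close> is 1 or 2.\<close>
  ultimately show ?thesis
    using wiener_index_escom[OF is_group]
    by (simp add: order_eq power2_eq_square field_simps)
qed

end
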